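(* There is an absolute constant $c>0$ such that for every integer $N\ge 2$ and every set $\mathcal A_N\subset[0,1]^2$ of $N$ points, \[ \|D_N\|_{\mathrm{BMO}_{1,2}}\ \ge\ c\,(\log N)^{1/2}. \]
   Context: For an $N$-point set $\mathcal A_N\subset[0,1]^2$, $D_N(\vec x)=\sharp\big(\mathcal A_N\cap[0,x_1)\times[0,x_2)\big)-Nx_1x_2$. Dyadic intervals are $[j2^{-k},(j+1)2^{-k})\subset[0,1)$; for such $I$ with left and right halves $I_{\mathrm{left}},I_{\mathrm{right}}$, $h_I=-\mathbf 1_{I_{\mathrm{left}}}+\mathbf 1_{I_{\mathrm{right}}}$. A dyadic rectangle is $R=R_1\times R_2$ with $R_1,R_2$ dyadic intervals, and $h_R(x_1,x_2)=h_{R_1}(x_1)h_{R_2}(x_2)$. The dyadic Chang–Fefferman BMO norm is \[\|f\|_{\mathrm{BMO}_{1,2}}=\sup_{U}\Big[|U|^{-1}\sum_{R\text{ dyadic},\,R\subset U}\frac{\langle f,h_R\rangle^2}{|R|}\Big]^{1/2},\] the supremum over all measurable $U\subset[0,1]^2$ of positive measure (not only rectangles), with $\langle\cdot,\cdot\rangle$ the $L^2([0,1]^2)$ inner product. *)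

theory Defs
  imports "HOL-Analysis.Analysis"
begin

abbreviation unit_square :: "(real \<times> real) set" where
  "unit_square \<equiv> {0..1} \<times> {0..1}"

definition discrepancy :: "(real \<times> real) set \<Rightarrow> real \<times> real \<Rightarrow> real" where
  "discrepancy A = (\<lambda>(x1, x2).
     real (card (A \<inter> ({0..<x1} \<times> {0..<x2}))) - real (card A) * x1 * x2)"

definition dyadic_interval :: "nat \<Rightarrow> nat \<Rightarrow> real set" where
  "dyadic_interval k j = {real j / 2 ^ k ..< real (j + 1) / 2 ^ k}"

text \<open>A dyadic subinterval of \<open>[0,1)\<close> is represented by its pair of indices \<open>(k, j)\<close>;
  this is a bijective encoding by the two lemmas below.\<close>

definition dyadic_indices :: "(nat \<times> nat) set" where
  "dyadic_indices = {(k, j). j < 2 ^ k}"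

lemma dyadic_interval_subset_iff:
  "dyadic_interval k j \<subseteq> {0..<1} \<longleftrightarrow> (k, j) \<in> dyadic_indices"
proof -
  have "real j / 2 ^ k < real (j + 1) / 2 ^ k"
    by (simp add: divide_strict_right_mono)
  then have "dyadic_interval k j \<subseteq> {0..<1} \<longleftrightarrow> real (j + 1) \<le> 2 ^ k"
    by (auto simp: dyadic_interval_def divide_le_eq
        dest!: atLeastLessThan_subset_iff)
  also have "\<dots> \<longleftrightarrow> j + 1 \<le> 2 ^ k"
    using of_nat_le_iff[where 'a = real, of "j + 1" "2 ^ k"] by simp
  finally show ?thesis by (auto simp: dyadic_indices_def)
qed

lemma inj_dyadic_interval: "inj (\<lambda>(k, j). dyadic_interval k j)"
proof (rule injI, clarify)
  fix k j k' j'
  assume eq: "dyadic_interval k j = dyadic_interval k' j'"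
  have lt: "real j / 2 ^ k < real (j + 1) / 2 ^ k" for j k :: nat
    by (simp add: divide_strict_right_mono)
  have *: "Inf (dyadic_interval k j) = real j / 2 ^ k"
    "Sup (dyadic_interval k j) = real (j + 1) / 2 ^ k" for j k
    unfolding dyadic_interval_def using lt[of j k]
    by simp_all
  have l: "real j / 2 ^ k = real j' / 2 ^ k'" using eq *(1) by metis
  have "real (j + 1) / 2 ^ k = real (j' + 1) / 2 ^ k'" using eq *(2) by metis
  with l have "(1::real) / 2 ^ k = 1 / 2 ^ k'"
    by (simp add: add_divide_distrib)
  then have "k = k'" by simp
  with l show "k = k' \<and> j = j'" by simp
qed

text \<open>The left and right halves of \<open>[j 2\<^sup>-\<^sup>k, (j+1) 2\<^sup>-\<^sup>k)\<close> are the dyadic intervals with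
  indices \<open>(k+1, 2j)\<close> and \<open>(k+1, 2j+1)\<close>.\<close>

definition haar :: "nat \<times> nat \<Rightarrow> real \<Rightarrow> real" where
  "haar = (\<lambda>(k, j) x.
     - indicator (dyadic_interval (Suc k) (2 * j)) x
     + indicator (dyadic_interval (Suc k) (2 * j + 1)) x)"

definition dyadic_rect :: "(nat \<times> nat) \<times> (nat \<times> nat) \<Rightarrow> (real \<times> real) set" where
  "dyadic_rect = (\<lambda>((k1, j1), (k2, j2)). dyadic_interval k1 j1 \<times> dyadic_interval k2 j2)"

definition haar_rect :: "(nat \<times> nat) \<times> (nat \<times> nat) \<Rightarrow> real \<times> real \<Rightarrow> real" where
  "haar_rect = (\<lambda>(p, q) (x1, x2). haar p x1 * haar q x2)"

definition l2_inner :: "(real \<times> real \<Rightarrow> real) \<Rightarrow> (real \<times> real \<Rightarrow> real) \<Rightarrow> real" where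
  "l2_inner f g = (LINT x:unit_square|lebesgue. f x * g x)"

definition ennreal_sqrt :: "ennreal \<Rightarrow> ennreal" where
  "ennreal_sqrt x = (if x = \<infinity> then \<infinity> else ennreal (sqrt (enn2real x)))"

text \<open>Both the infinite sum and the supremum are taken in the extended nonnegative reals,
  where they always exist; the norm of \<open>f\<close> is meaningful for \<open>f\<close> integrable on the unit square.\<close>

definition bmo_norm :: "(real \<times> real \<Rightarrow> real) \<Rightarrow> ennreal" where
  "bmo_norm f =
     (SUP U \<in> {U \<in> sets lebesgue. U \<subseteq> unit_square \<and> emeasure lebesgue U > 0}.
        ennreal_sqrt
          ((\<Sum>\<^sub>\<infinity> R \<in> {R \<in> dyadic_indices \<times> dyadic_indices. dyadic_rect R \<subseteq> U}.
              ennreal ((l2_inner f (haar_rect R))\<^sup>2 / measure lebesgue (dyadic_rect R)))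
           / emeasure lebesgue U))"

end

theory Submission
  imports Defs
begin

text \<open>Take \<open>U\<close> to be the whole square and choose \<open>n\<close> with \<open>2N < 2\<^sup>n \<le> 4N\<close>. For each of the
  \<open>n + 1\<close> shapes \<open>2\<^sup>-\<^sup>k \<times> 2\<^sup>-\<^sup>(\<^sup>n\<^sup>-\<^sup>k\<^sup>)\<close> at least half of the \<open>2\<^sup>n\<close> dyadic rectangles contain no point
  of \<open>A\<close>. The counting part of the discrepancy is orthogonal to the Haar function of such a
  rectangle, and the linear part contributes the coefficient \<open>- N 4\<^sup>-\<^sup>n / 16\<close>. Summing the squares
  gives a constant for each shape, hence at least a multiple of \<open>n\<close>.\<close>

section \<open>Integrals of products and of elementary functions on intervals\<close>

lemma has_bochner_integral_lborel_mult:
  fixes u v :: "real \<Rightarrow> real"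
  assumes u: "has_bochner_integral lborel u I" and v: "has_bochner_integral lborel v J"
  shows "has_bochner_integral lborel (\<lambda>(x, y). u x * v y) (I * J)"
proof -
  have [measurable]: "u \<in> borel_measurable borel" "v \<in> borel_measurable borel"
    using u v by (auto simp: has_bochner_integral_iff dest: borel_measurable_integrable)
  have int: "integrable (lborel \<Otimes>\<^sub>M lborel) (\<lambda>(x, y). u x * v y)"
    using u v by (intro lborel_pair.Fubini_integrable)
      (auto simp: has_bochner_integral_iff abs_mult)
  then have "integral\<^sup>L (lborel \<Otimes>\<^sub>M lborel) (\<lambda>(x, y). u x * v y)
      = (\<integral>x. (\<integral>y. u x * v y \<partial>lborel) \<partial>lborel)"
    using lborel_pair.integral_fst[OF int] by simp
  also have "\<dots> = I * J" using u v by (simp add: has_bochner_integral_iff)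
  finally show ?thesis using int by (simp add: has_bochner_integral_iff lborel_prod)
qed

lemma has_bochner_integral_indicator_Ico:
  fixes a b :: real
  assumes "a \<le> b"
  shows "has_bochner_integral lborel (indicator {a..<b}) (b - a)"
  using assms has_bochner_integral_real_indicator[of "{a..<b}" lborel] by simp

lemma has_bochner_integral_ident_indicator_Ico:
  fixes a b :: real
  assumes "a \<le> b"
  shows "has_bochner_integral lborel (\<lambda>x. x * indicator {a..<b} x) ((b\<^sup>2 - a\<^sup>2) / 2)"
proof -
  have "has_bochner_integral lborel (\<lambda>x. x * indicator {a..b} x) (b\<^sup>2 / 2 - a\<^sup>2 / 2)"
    using assms by (intro has_bochner_integral_FTC_Icc_real[where F = "\<lambda>x. x\<^sup>2 / 2"])
      (auto intro!: derivative_eq_intros continuous_intros)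
  \<comment> \<open>The fundamental theorem needs the closed interval; the extra endpoint
    \<open>b\<close> is a null set.\<close>
  moreover have "AE x in lborel. x * indicator {a..b} x = x * indicator {a..<b} x"
    using AE_lborel_singleton[of b] by eventually_elim (auto simp: indicator_def)
  ultimately show ?thesis
    by (subst (asm) has_bochner_integral_cong_AE) (auto simp: diff_divide_distrib)
qed

section \<open>One-dimensional Haar functions: moments and support\<close>

lemma haar_eq:
  "haar (k, j) x = indicator {(real j + 1/2) / 2 ^ k ..< (real j + 1) / 2 ^ k} x
     - indicator {real j / 2 ^ k ..< (real j + 1/2) / 2 ^ k} x"
proof -
  have "real (2 * j) / 2 ^ Suc k = real j / 2 ^ k"
    "real (2 * j + 1) / 2 ^ Suc k = (real j + 1/2) / 2 ^ k"
    "real (2 * j + 1 + 1) / 2 ^ Suc k = (real j + 1) / 2 ^ k"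
    by (simp_all add: field_simps)
  then show ?thesis by (simp add: haar_def dyadic_interval_def)
qed

lemma dyadic_split_le:
  "real j / 2 ^ k \<le> (real j + 1/2) / 2 ^ k" "(real j + 1/2) / 2 ^ k \<le> (real j + 1) / 2 ^ k"
  by (auto intro!: divide_right_mono)

text \<open>The mean of the Haar function vanishes, so the value cannot depend on \<open>j\<close>:
  both halves have length \<open>1 / 2 ^ (k + 1)\<close> and their midpoints are that same distance
  apart.\<close>

lemma has_bochner_integral_ident_haar:
  "has_bochner_integral lborel (\<lambda>x. x * haar (k, j) x) (1 / (4 * (2 ^ k)\<^sup>2))"
proof -
  have "has_bochner_integral lborel (\<lambda>x. x * haar (k, j) x)
     (((((real j + 1) / 2 ^ k)\<^sup>2 - ((real j + 1/2) / 2 ^ k)\<^sup>2) / 2)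
      - ((((real j + 1/2) / 2 ^ k)\<^sup>2 - (real j / 2 ^ k)\<^sup>2) / 2))"
    unfolding haar_eq right_diff_distrib
    by (intro has_bochner_integral_diff has_bochner_integral_ident_indicator_Ico dyadic_split_le)
  moreover have "(((((real j + 1) / 2 ^ k)\<^sup>2 - ((real j + 1/2) / 2 ^ k)\<^sup>2) / 2)
      - ((((real j + 1/2) / 2 ^ k)\<^sup>2 - (real j / 2 ^ k)\<^sup>2) / 2)) = 1 / (4 * (2 ^ k)\<^sup>2)"
    by (simp add: power_divide field_simps) (simp add: power2_eq_square algebra_simps)
  ultimately show ?thesis by simp
qed

lemma integrable_indicator_haar:
  "integrable lborel (\<lambda>x. indicator {a<..} x * haar (k, j) x)"
proof (rule Bochner_Integration.integrable_bound)
  show "integrable lborel (\<lambda>x. indicator {real j / 2 ^ k..<(real j + 1) / 2 ^ k} x :: real)"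
    using has_bochner_integral_indicator_Ico dyadic_split_le order_trans
    unfolding has_bochner_integral_iff by blast
  show "(\<lambda>x. indicator {a<..} x * haar (k, j) x) \<in> borel_measurable lborel"
    unfolding haar_eq by measurable
  show "AE x in lborel. norm (indicator {a<..} x * haar (k, j) x)
      \<le> norm (indicator {real j / 2 ^ k..<(real j + 1) / 2 ^ k} x :: real)"
    using dyadic_split_le[of j k] unfolding haar_eq by (auto simp: indicator_def)
qed

lemma has_bochner_integral_haar: "has_bochner_integral lborel (haar p) 0"
proof -
  obtain k j where p: "p = (k, j)" by (cases p)
  have "has_bochner_integral lborel (haar (k, j))
     (((real j + 1) / 2 ^ k - (real j + 1/2) / 2 ^ k) - ((real j + 1/2) / 2 ^ k - real j / 2 ^ k))"
    unfolding haar_eq[abs_def]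
    by (intro has_bochner_integral_diff has_bochner_integral_indicator_Ico dyadic_split_le)
  then show ?thesis by (simp add: p field_simps)
qed

text \<open>The jump at \<open>a\<close> falls outside the support of the Haar function. On that
  support the cut-off is therefore constantly 1, which leaves the zero mean, or constantly
  0.\<close>

lemma integral_indicator_haar:
  assumes "a \<notin> dyadic_interval k j"
  shows "(LINT x|lborel. indicator {a<..} x * haar (k, j) x) = 0"
proof -
  consider "a < real j / 2 ^ k" | "a \<ge> (real j + 1) / 2 ^ k"
    using assms by (force simp: dyadic_interval_def add.commute)
  then show ?thesis
  proof cases
    case 1
    then have "(\<lambda>x. indicator {a<..} x * haar (k, j) x) = haar (k, j)"
      using dyadic_split_le[of j k] by (auto simp: haar_eq indicator_def)
    then show ?thesis using has_bochner_integral_haar by (simp add: has_bochner_integral_iff)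
  next
    case 2
    then have "(\<lambda>x. indicator {a<..} x * haar (k, j) x) = (\<lambda>x. 0)"
      using dyadic_split_le[of j k] by (auto simp: haar_eq indicator_def)
    then show ?thesis by simp
  qed
qed

text \<open>This lets integrals over \<open>unit_square\<close> be taken over the whole plane, where
  Fubini applies without truncation.\<close>

lemma haar_eq_0:
  assumes "p \<in> dyadic_indices" "x \<notin> {0..1}"
  shows "haar p x = 0"
proof -
  obtain k j where p: "p = (k, j)" by (cases p)
  have "dyadic_interval k j \<subseteq> {0..<1}"
    using assms p dyadic_interval_subset_iff by simp
  then have "x \<notin> dyadic_interval k j" using assms(2) by force
  then have "x < real j / 2 ^ k \<or> x \<ge> (real j + 1) / 2 ^ k"
    by (force simp: dyadic_interval_def add.commute)
  then show ?thesis
    using dyadic_split_le[of j k] unfolding p haar_eq by (auto simp: indicator_def)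
qed

section \<open>Haar coefficients of the discrepancy on empty rectangles\<close>

lemma card_Int_box:
  fixes A :: "(real \<times> real) set"
  assumes "finite A" "A \<subseteq> unit_square"
  shows "real (card (A \<inter> ({0..<x} \<times> {0..<y})))
    = (\<Sum>a\<in>A. indicator {fst a<..} x * indicator {snd a<..} y)"
proof -
  have "real (card (A \<inter> ({0..<x} \<times> {0..<y}))) = (\<Sum>a\<in>A. indicator ({0..<x} \<times> {0..<y}) a)"
    using assms(1) by (simp add: indicator_def of_bool_def sum.If_cases)
  \<comment> \<open>Points of \<open>A\<close> have nonnegative coordinates, so the lower bounds of
    the box hold automatically and each point contributes a product of one-variable
    functions.\<close>
  also have "\<dots> = (\<Sum>a\<in>A. indicator {fst a<..} x * indicator {snd a<..} y)"
    using assms(2) by (intro sum.cong) (auto simp: indicator_def)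
  finally show ?thesis .
qed

text \<open>Each point of \<open>A\<close> misses at least one side of the rectangle, so one factor
  of its product integral is zero. Only the linear part survives, with the product of two first
  moments of Haar functions.\<close>

lemma l2_inner_discrepancy_haar:
  assumes A: "finite A" "A \<subseteq> unit_square"
    and idx: "(k1, j1) \<in> dyadic_indices" "(k2, j2) \<in> dyadic_indices"
    and empty: "A \<inter> dyadic_rect ((k1, j1), (k2, j2)) = {}"
  shows "l2_inner (discrepancy A) (haar_rect ((k1, j1), (k2, j2)))
    = - real (card A) / (16 * (2 ^ (k1 + k2))\<^sup>2)"
proof -
  let ?p = "(k1, j1)" and ?q = "(k2, j2)"
  \<comment> \<open>\<open>F\<close> is the integrand extended by zero to the plane, with the
    counting part expanded into separated products.\<close>
  define F where "F = (\<lambda>(x, y).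
     (\<Sum>a\<in>A. (\<lambda>(x, y). (indicator {fst a<..} x * haar ?p x) * (indicator {snd a<..} y * haar ?q y)) (x, y))
     - real (card A) * (\<lambda>(x, y). (x * haar ?p x) * (y * haar ?q y)) (x, y))"
  have F_eq: "indicator unit_square z *\<^sub>R (discrepancy A z * haar_rect (?p, ?q) z) = F z" for z
  proof (cases z)
    case (Pair x y)
    show ?thesis
    proof (cases "x \<in> {0..1} \<and> y \<in> {0..1}")
      case True
      then show ?thesis
        by (simp add: Pair F_def discrepancy_def haar_rect_def card_Int_box[OF A]
            left_diff_distrib right_diff_distrib sum_distrib_right sum_distrib_left mult_ac)
    next
      case False
      then have "haar ?p x = 0 \<or> haar ?q y = 0" using idx haar_eq_0 by blast
      then show ?thesis by (auto simp: Pair F_def haar_rect_def)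
    qed
  qed
  define I where "I = (\<lambda>a. (LINT x|lborel. indicator {fst a<..} x * haar ?p x)
     * (LINT x|lborel. indicator {snd a<..} x * haar ?q x))"
  have "has_bochner_integral lborel F
     ((\<Sum>a\<in>A. I a) - real (card A) * ((1 / (4 * (2 ^ k1)\<^sup>2)) * (1 / (4 * (2 ^ k2)\<^sup>2))))"
    unfolding F_def I_def case_prod_beta prod.collapse
    by (intro has_bochner_integral_diff has_bochner_integral_sum
        has_bochner_integral_mult_right
        has_bochner_integral_lborel_mult[unfolded case_prod_beta]
        has_bochner_integral_ident_haar has_bochner_integral_integrable integrable_indicator_haar)
  moreover have "I a = 0" if "a \<in> A" for a
  proof -
    have "fst a \<notin> dyadic_interval k1 j1 \<or> snd a \<notin> dyadic_interval k2 j2"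
      using empty that by (cases a) (auto simp: dyadic_rect_def)
    then show ?thesis using integral_indicator_haar by (auto simp: I_def)
  qed
  ultimately have F: "has_bochner_integral lborel F
     (- real (card A) * ((1 / (4 * (2 ^ k1)\<^sup>2)) * (1 / (4 * (2 ^ k2)\<^sup>2))))"
    by simp
  have "l2_inner (discrepancy A) (haar_rect (?p, ?q)) = (LINT z|lebesgue. F z)"
    by (simp only: l2_inner_def set_lebesgue_integral_def F_eq)
  \<comment> \<open>\<open>F\<close> is Borel measurable, so passing to the completed measure does
    not change its integral.\<close>
  also have "\<dots> = (LINT z|lborel. F z)"
    using F by (intro integral_completion) (auto simp: has_bochner_integral_iff)
  also have "\<dots> = - real (card A) / (16 * (2 ^ (k1 + k2))\<^sup>2)"
    using F by (simp add: has_bochner_integral_iff power_add power_mult_distrib)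
  finally show ?thesis .
qed

section \<open>Area and counting of dyadic rectangles\<close>

lemma measure_dyadic_rect:
  "measure lebesgue (dyadic_rect ((k1, j1), (k2, j2))) = 1 / 2 ^ (k1 + k2)"
proof -
  have len: "emeasure lborel (dyadic_interval k j) = ennreal (1 / 2 ^ k)" for k j
    unfolding dyadic_interval_def
    by (subst emeasure_lborel_Ico) (auto simp: add_divide_distrib divide_right_mono)
  have [measurable]: "dyadic_interval k j \<in> sets borel" for k j
    by (simp add: dyadic_interval_def)
  have "emeasure (lborel \<Otimes>\<^sub>M lborel) (dyadic_interval k1 j1 \<times> dyadic_interval k2 j2)
     = ennreal (1 / 2 ^ k1) * ennreal (1 / 2 ^ k2)"
    by (subst lborel.emeasure_pair_measure_Times) (simp_all add: len)
  also have "\<dots> = ennreal (1 / 2 ^ (k1 + k2))"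
    by (simp flip: ennreal_mult add: power_add)
  finally have "measure lborel (dyadic_interval k1 j1 \<times> dyadic_interval k2 j2) = 1 / 2 ^ (k1 + k2)"
    by (simp add: measure_def lborel_prod)
  moreover have "dyadic_interval k1 j1 \<times> dyadic_interval k2 j2 \<in> sets borel"
    by (simp flip: borel_prod)
  ultimately show ?thesis
    by (simp add: dyadic_rect_def)
qed

text \<open>Dyadic intervals of one level are disjoint; the explicit index shows that a point meets
  at most one rectangle of each shape.\<close>

lemma dyadic_interval_index:
  assumes "x \<in> dyadic_interval k j"
  shows "j = nat \<lfloor>x * 2 ^ k\<rfloor>"
proof -
  have "real j \<le> x * 2 ^ k" "x * 2 ^ k < real j + 1"
    using assms by (auto simp: dyadic_interval_def field_simps)
  then have "\<lfloor>x * 2 ^ k\<rfloor> = int j" by (intro floor_unique) auto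
  then show ?thesis by simp
qed

text \<open>There are \<open>2 ^ n\<close> rectangles of each of the \<open>n + 1\<close> shapes,
  and every point of \<open>A\<close> spoils at most one per shape.\<close>

lemma card_empty_dyadic_rects:
  fixes A :: "(real \<times> real) set"
  assumes "finite A"
  obtains G where "finite G" "(n + 1) * 2 ^ n \<le> card G + (n + 1) * card A"
    "\<And>R. R \<in> G \<Longrightarrow> A \<inter> dyadic_rect R = {}"
    "\<And>R. R \<in> G \<Longrightarrow> \<exists>k1 j1 k2 j2. R = ((k1, j1), (k2, j2)) \<and> (k1, j1) \<in> dyadic_indices \<and>
        (k2, j2) \<in> dyadic_indices \<and> k1 + k2 = n"
proof -
  define S where "S = (SIGMA k:{..n}. {..<2 ^ k} \<times> {..<2 ^ (n - k)} :: (nat \<times> nat \<times> nat) set)"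
  define r :: "nat \<times> nat \<times> nat \<Rightarrow> (nat \<times> nat) \<times> (nat \<times> nat)"
    where "r = (\<lambda>(k, i, j). ((k, i), (n - k, j)))"
  define T where "T = r ` S"
  \<comment> \<open>For each shape and each point, \<open>B\<close> holds the only candidate
    rectangle containing that point. Some candidates may lie outside \<open>T\<close>, which is
    harmless because only an upper bound on \<open>card B\<close> enters.\<close>
  define B where "B = (\<lambda>(k, a). ((k, nat \<lfloor>fst a * 2 ^ k\<rfloor>), (n - k, nat \<lfloor>snd a * 2 ^ (n - k)\<rfloor>)))
     ` ({..n} \<times> A)"
  have "inj_on r S" by (auto simp: inj_on_def r_def)
  then have "card T = card S" by (simp add: T_def card_image)
  also have "\<dots> = (\<Sum>k\<le>n. 2 ^ k * 2 ^ (n - k))"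
    unfolding S_def by (subst card_SigmaI) auto
  also have "\<dots> = (\<Sum>k\<le>n. 2 ^ n)"
    by (intro sum.cong) (auto simp flip: power_add)
  also have "\<dots> = (n + 1) * 2 ^ n" by simp
  finally have T: "card T = (n + 1) * 2 ^ n" .
  have finT: "finite T" by (simp add: T_def S_def)
  have "card B \<le> card ({..n} \<times> A)"
    unfolding B_def using assms by (intro card_image_le) auto
  then have B: "card B \<le> (n + 1) * card A" by (simp add: card_cartesian_product)
  have finB: "finite B" using assms by (simp add: B_def)
  show thesis
  proof (rule that[of "T - B"])
    show "finite (T - B)" using finT by simp
    show "(n + 1) * 2 ^ n \<le> card (T - B) + (n + 1) * card A"
      using diff_card_le_card_Diff[OF finB, of T] B T by linarith
    show "A \<inter> dyadic_rect R = {}" if "R \<in> T - B" for R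
    proof (rule ccontr)
      assume "A \<inter> dyadic_rect R \<noteq> {}"
      then obtain a where a: "a \<in> A" "a \<in> dyadic_rect R" by blast
      obtain k i j where R: "R = ((k, i), (n - k, j))" "k \<le> n"
        using \<open>R \<in> T - B\<close> by (auto simp: T_def S_def r_def)
      have "i = nat \<lfloor>fst a * 2 ^ k\<rfloor>" "j = nat \<lfloor>snd a * 2 ^ (n - k)\<rfloor>"
        using a(2) R by (auto simp: dyadic_rect_def intro!: dyadic_interval_index)
      then have "R \<in> B" using R a(1) by (force simp: B_def)
      then show False using that by simp
    qed
    show "\<exists>k1 j1 k2 j2. R = ((k1, j1), (k2, j2)) \<and> (k1, j1) \<in> dyadic_indices \<and>
        (k2, j2) \<in> dyadic_indices \<and> k1 + k2 = n" if "R \<in> T - B" for R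
      using that by (auto simp: T_def S_def r_def dyadic_indices_def)
  qed
qed

section \<open>Bounding the norm from below by finite sums\<close>

lemma ennreal_sqrt_ge:
  assumes "ennreal x \<le> y" "0 \<le> x"
  shows "ennreal (sqrt x) \<le> ennreal_sqrt y"
proof (cases "y = \<infinity>")
  case False
  then have "x \<le> enn2real y"
    using assms by (metis enn2real_ennreal enn2real_mono infinity_ennreal_def top.not_eq_extremum)
  then show ?thesis using False by (simp add: ennreal_sqrt_def ennreal_leI)
qed (simp add: ennreal_sqrt_def)

text \<open>The unit square is admissible as \<open>U\<close> and has measure 1, so the
  normalisation disappears; all terms are nonnegative, so a finite subfamily bounds the full sum
  from below.\<close>

lemma bmo_norm_ge:
  assumes G: "finite G" "G \<subseteq> dyadic_indices \<times> dyadic_indices"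
  shows "ennreal (sqrt (\<Sum>R\<in>G. (l2_inner f (haar_rect R))\<^sup>2 / measure lebesgue (dyadic_rect R)))
    \<le> bmo_norm f"
proof -
  let ?t = "\<lambda>R. (l2_inner f (haar_rect R))\<^sup>2 / measure lebesgue (dyadic_rect R)"
  let ?S = "{R \<in> dyadic_indices \<times> dyadic_indices. dyadic_rect R \<subseteq> unit_square}"
  have box: "unit_square = cbox (0, 0) (1, 1)" by (simp add: cbox_Pair_eq)
  have one: "emeasure lebesgue unit_square = 1"
  proof -
    have "emeasure lborel (cbox (0::real, 0::real) (1, 1)) = 1"
      by (subst emeasure_lborel_cbox) (auto simp: Basis_prod_def)
    then show ?thesis by (simp add: box)
  qed
  have sub: "dyadic_rect R \<subseteq> unit_square" if "R \<in> dyadic_indices \<times> dyadic_indices" for R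
  proof -
    obtain k1 j1 k2 j2 where R: "R = ((k1, j1), (k2, j2))" by (metis surj_pair)
    have "dyadic_interval k1 j1 \<subseteq> {0..<1}" "dyadic_interval k2 j2 \<subseteq> {0..<1}"
      using that R dyadic_interval_subset_iff by auto
    moreover have "{0..<1::real} \<subseteq> {0..1}" by auto
    ultimately show ?thesis unfolding R dyadic_rect_def by (auto simp: subset_iff)
  qed
  have "G \<subseteq> ?S"
  proof
    fix R assume "R \<in> G"
    then have "R \<in> dyadic_indices \<times> dyadic_indices" using G(2) by (rule rev_subsetD)
    then show "R \<in> ?S" using sub[of R] by simp
  qed
  have "ennreal (\<Sum>R\<in>G. ?t R) = (\<Sum>R\<in>G. ennreal (?t R))"
    by (subst sum_ennreal) auto
  also have "\<dots> = (\<Sum>\<^sub>\<infinity>R\<in>G. ennreal (?t R))"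
    using G(1) by simp
  also have "\<dots> \<le> (\<Sum>\<^sub>\<infinity>R\<in>?S. ennreal (?t R))"
    using \<open>G \<subseteq> ?S\<close> by (intro infsum_mono_neutral nonneg_summable_on_complete) auto
  finally have "ennreal (sqrt (\<Sum>R\<in>G. ?t R))
      \<le> ennreal_sqrt ((\<Sum>\<^sub>\<infinity>R\<in>?S. ennreal (?t R)) / emeasure lebesgue unit_square)"
    unfolding one by (intro ennreal_sqrt_ge) (auto intro!: sum_nonneg simp: divide_ennreal_def)
  also have "\<dots> \<le> bmo_norm f"
    unfolding bmo_norm_def
    by (rule SUP_upper) (simp add: one, simp add: box)
  finally show ?thesis .
qed

section \<open>Choice of scale and the final estimate\<close>

theorem theorem1p4:
  shows "\<exists>c::real. c > 0 \<and>
    (\<forall>(N::nat) (A :: (real \<times> real) set).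
       N \<ge> 2 \<longrightarrow> A \<subseteq> unit_square \<longrightarrow> finite A \<longrightarrow> card A = N \<longrightarrow>
       bmo_norm (discrepancy A) \<ge> ennreal (c * sqrt (ln (real N))))"
proof (intro exI[of _ "1/100"] conjI allI impI)
  fix N :: nat and A :: "(real \<times> real) set"
  assume N: "N \<ge> 2" and A: "A \<subseteq> unit_square" "finite A" and card: "card A = N"
  obtain m where m: "2 ^ m \<le> N" "N < 2 ^ (m + 1)"
    using ex_power_ivl1[of 2 N] N by auto
  \<comment> \<open>The shift by 2 turns \<open>2 ^ m \<le> N < 2 ^ (m + 1)\<close> into the bounds
    that follow: enough rectangles to leave half of them empty, yet areas still comparable to
    \<open>1 / N\<close>.\<close>
  define n where "n = m + 2"
  have n: "2 * N < 2 ^ n" "2 ^ n \<le> 4 * N" using m by (auto simp: n_def)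
  obtain G where G: "finite G" "(n + 1) * 2 ^ n \<le> card G + (n + 1) * card A"
    and G_empty: "\<And>R. R \<in> G \<Longrightarrow> A \<inter> dyadic_rect R = {}"
    and G_shape: "\<And>R. R \<in> G \<Longrightarrow> \<exists>k1 j1 k2 j2. R = ((k1, j1), (k2, j2)) \<and>
        (k1, j1) \<in> dyadic_indices \<and> (k2, j2) \<in> dyadic_indices \<and> k1 + k2 = n"
    using card_empty_dyadic_rects[OF A(2), of n] by metis
  let ?M = "2 ^ n :: real"
  let ?t = "\<lambda>R. (l2_inner (discrepancy A) (haar_rect R))\<^sup>2 / measure lebesgue (dyadic_rect R)"
  \<comment> \<open>Coefficient and area depend only on \<open>k1 + k2 = n\<close>, so all
    rectangles in \<open>G\<close> contribute equally.\<close>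
  have t: "?t R = (real N)\<^sup>2 / (256 * ?M ^ 3)" if R: "R \<in> G" for R
  proof -
    obtain k1 j1 k2 j2 where *: "R = ((k1, j1), (k2, j2))" "(k1, j1) \<in> dyadic_indices"
      "(k2, j2) \<in> dyadic_indices" "k1 + k2 = n"
      using G_shape[OF R] by blast
    have "?t R = (- real N / (16 * ?M\<^sup>2))\<^sup>2 / (1 / ?M)"
      using l2_inner_discrepancy_haar[OF A(2,1) *(2,3)] G_empty[OF R] *(1,4) card
      by (simp add: measure_dyadic_rect)
    also have "\<dots> = (real N)\<^sup>2 / (256 * ?M ^ 3)"
      by (simp add: power_divide power_mult_distrib) (simp add: field_simps eval_nat_numeral)
    finally show ?thesis .
  qed
  have nR: "2 * real N \<le> ?M" "?M \<le> 4 * real N"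
    using n of_nat_le_iff[where 'a = real, of "2 * N" "2 ^ n"]
      of_nat_le_iff[where 'a = real, of "2 ^ n" "4 * N"] by simp_all
  have "real ((n + 1) * 2 ^ n) \<le> real (card G + (n + 1) * N)"
    using G(2) card of_nat_le_iff by blast
  then have "(real n + 1) * ?M \<le> real (card G) + (real n + 1) * real N"
    by (simp add: algebra_simps)
  moreover have "(real n + 1) * (2 * real N) \<le> (real n + 1) * ?M"
    using nR(1) by (intro mult_left_mono) auto
  \<comment> \<open>Since \<open>N\<close> is at most \<open>?M / 2\<close>, the spoiled rectangles
    make up at most half of all \<open>(n + 1) * 2 ^ n\<close>.\<close>
  ultimately have cardG: "(real n + 1) * ?M / 2 \<le> real (card G)"
    by (simp add: algebra_simps)
  have "real N \<le> ?M" using nR(1) by linarith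
  then have "ln (real N) \<le> ln ?M" using N by (subst ln_le_cancel_iff) auto
  also have "\<dots> = real n * ln 2" by (simp add: ln_realpow)
  also have "\<dots> \<le> real n * 1" using ln_2_less_1 by (intro mult_left_mono) auto
  finally have lnN: "ln (real N) \<le> real n + 1" by simp
  have "?M\<^sup>2 \<le> (4 * real N)\<^sup>2" using nR by (intro power_mono) auto
  then have sq: "?M\<^sup>2 / 16 \<le> (real N)\<^sup>2" by simp
  \<comment> \<open>Here \<open>8192 = 2 * 16 * 256\<close> collects the losses from counting, from
    \<open>sq\<close> and from the squared coefficient; \<open>10000\<close> rounds it up to a
    square, whence the constant \<open>1/100\<close>.\<close>
  have "ln (real N) / 10000 \<le> (real n + 1) / 8192"
    using lnN N by simp
  \<comment> \<open>The powers of \<open>?M\<close> cancel: the number of rectangles supplies one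
    factor and \<open>N\<close> squared supplies two.\<close>
  also have "\<dots> = ((real n + 1) * ?M / 2) * ((?M\<^sup>2 / 16) / (256 * ?M ^ 3))"
    by (simp add: field_simps eval_nat_numeral)
  also have "\<dots> \<le> real (card G) * ((real N)\<^sup>2 / (256 * ?M ^ 3))"
    using cardG sq by (intro mult_mono divide_right_mono) auto
  also have "\<dots> = (\<Sum>R\<in>G. ?t R)" using t by simp
  finally have "sqrt (ln (real N) / 10000) \<le> sqrt (\<Sum>R\<in>G. ?t R)"
    by (rule real_sqrt_le_mono)
  moreover have "sqrt (ln (real N) / 10000) = 1/100 * sqrt (ln (real N))"
    using real_sqrt_abs[of 100] by (simp add: real_sqrt_divide)
  ultimately have "ennreal (1/100 * sqrt (ln (real N))) \<le> ennreal (sqrt (\<Sum>R\<in>G. ?t R))"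
    by (simp add: ennreal_leI)
  also have "\<dots> \<le> bmo_norm (discrepancy A)"
    using G(1) G_shape by (intro bmo_norm_ge) force+
  finally show "ennreal (1/100 * sqrt (ln (real N))) \<le> bmo_norm (discrepancy A)" .
qed simp

end
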